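(* $\lceil \langle \mathrm{rDiv} \rangle^z \rceil_{z \in \mathbb{N}} \leq_2 \mathrm{BLinIneq}$; that is, the supremum over $z$ of the $z$-fold products of robust division is reducible to the problem of finding a solution of a solvable system of linear inequalities with solution vector bounded in $[0,1]^m$.
   Context: Representation of reals. Fix a bijection $\nu:\mathbb{N}\to\mathbb{Q}$ with $\nu(0)=0$ such that the usual operations on $\mathbb{Q}$ are computable with respect to $\nu$. A sequence $w\in\mathbb{N}^{\mathbb{N}}$ is a $\rho$-name of $x\in\mathbb{R}$, written $\rho(w)=x$, if $|\nu(w(i))-x|\le 2^{-i}$ for all $i\in\mathbb{N}$. A $\rho^k$-name of a vector in $\mathbb{R}^k$ is a $k$-tuple of $\rho$-names of its entries. Problems and reducibility. $\mathbb{N}^{\mathbb{N}}$ carries its usual (Baire) topology, countable sets such as $\mathbb{N}$ or finite sets are discrete, products carry the product topology. A problem (multi-valued function) $P$ has a domain $\mathrm{dom}(P)$ of inputs (names) and assigns to each input a nonempty set of admissible outputs (names); $P$ is identified with the set of its choice functions, i.e. all functions $f$ on $\mathrm{dom}(P)$ with $f(w)$ admissible for every $w$. $P\le_2 Q$ holds iff there are continuous partial functions $F,G$ such that for each $g\in Q$ the function $w\mapsto F(w,g(G(w)))$ belongs to $P$ (in particular is defined on $\mathrm{dom}(P)$). Products and suprema. $\langle P,Q\rangle$ is the problem with inputs $(x,u)\in \mathrm{dom}(P)\times\mathrm{dom}(Q)$ and admissible outputs all pairs $(y,v)$ with $y$ admissible for $x$ in $P$ and $v$ admissible for $u$ in $Q$;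 $\langle P\rangle^1=P$, $\langle P\rangle^{z+1}=\langle P,\langle P\rangle^z\rangle$, $z\ge1$. For a countable family $(P_i)$, $\lceil P_i\rceil_i$ denotes its supremum with respect to $\le_2$, realized by the problem with inputs $(i,w)$, $w\in\mathrm{dom}(P_i)$, and the admissible outputs of $P_i$ on $w$. Robust division. $\mathrm{rDiv}$ is the set of functions $d$ defined on $\{(u,v)\mid 0\le\rho(u)\le\rho(v)\}$ (pairs of $\rho$-names), whose values are $\rho$-names of real numbers, satisfying $\rho(d(u,v))=\rho(u)/\rho(v)$ whenever $\rho(v)>0$ (the value is an arbitrary real if $\rho(v)=0$). Linear inequalities. $\mathrm{BLinIneq}_{nm}$ is the problem: given a $\rho^{nm}$-name of a real $n\times m$ matrix $A$ and a $\rho^n$-name of a vector $b\in\mathbb{R}^n$ such that there is a $v\in\mathbb{R}^m$ with $Av\le b$ and $0\le v\le1$ (componentwise), find a $\rho^m$-name of such a $v$. For simplicity it is assumed that the system $Av\le b$ always contains the inequalities $0\le v\le1$. $\mathrm{BLinIneq}$ is the problem without fixed $n,m$, i.e. the supremum $\lceil\mathrm{BLinIneq}_{nm}\rceil_{n,m}$. *)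

theory Defs
  imports "HOL-Analysis.Function_Topology" "Jordan_Normal_Form.Matrix"
begin

section \<open>Topology on names\<close>

text \<open>Finite tuples of varying length are lists. The topology on lists is the disjoint union, over
  the lengths \<open>k\<close>, of the \<open>k\<close>-fold product topologies.\<close>

instantiation list :: (topological_space) topological_space
begin

definition open_list :: "'a list set \<Rightarrow> bool" where
  "open_list U \<longleftrightarrow> (\<forall>xs\<in>U. \<exists>Vs. list_all2 (\<lambda>x V. open V \<and> x \<in> V) xs Vs \<and>
     (\<forall>ys. list_all2 (\<in>) ys Vs \<longrightarrow> ys \<in> U))"

instance
proof
  show "open (UNIV :: 'a list set)"
    unfolding open_list_def
    by (auto intro!: exI[of _ "map (\<lambda>_. UNIV) xs" for xs] simp: list_all2_conv_all_nth)
next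
  fix S T :: "'a list set"
  assume S: "open S" and T: "open T"
  show "open (S \<inter> T)"
    unfolding open_list_def
  proof
    fix xs assume xs: "xs \<in> S \<inter> T"
    obtain Vs where Vs: "list_all2 (\<lambda>x V. open V \<and> x \<in> V) xs Vs"
        "\<forall>ys. list_all2 (\<in>) ys Vs \<longrightarrow> ys \<in> S"
      using S xs unfolding open_list_def by blast
    obtain Ws where Ws: "list_all2 (\<lambda>x V. open V \<and> x \<in> V) xs Ws"
        "\<forall>ys. list_all2 (\<in>) ys Ws \<longrightarrow> ys \<in> T"
      using T xs unfolding open_list_def by blast
    have len: "length xs = length Vs" "length Vs = length Ws"
      using Vs(1) Ws(1) by (auto simp: list_all2_conv_all_nth)
    show "\<exists>Us. list_all2 (\<lambda>x V. open V \<and> x \<in> V) xs Us \<and>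
        (\<forall>ys. list_all2 (\<in>) ys Us \<longrightarrow> ys \<in> S \<inter> T)"
    proof (intro exI conjI allI impI)
      show "list_all2 (\<lambda>x V. open V \<and> x \<in> V) xs (map2 (\<inter>) Vs Ws)"
        using Vs(1) Ws(1) len by (auto simp: list_all2_conv_all_nth)
    next
      fix ys assume "list_all2 (\<in>) ys (map2 (\<inter>) Vs Ws)"
      then have "list_all2 (\<in>) ys Vs" "list_all2 (\<in>) ys Ws"
        using len by (auto simp: list_all2_conv_all_nth)
      then show "ys \<in> S \<inter> T" using Vs(2) Ws(2) by blast
    qed
  qed
next
  fix K :: "'a list set set"
  assume K: "\<forall>S\<in>K. open S"
  show "open (\<Union>K)"
    unfolding open_list_def
  proof
    fix xs assume "xs \<in> \<Union>K"
    then obtain S where S: "S \<in> K" "xs \<in> S" by blast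
    then obtain Vs where "list_all2 (\<lambda>x V. open V \<and> x \<in> V) xs Vs"
        "\<forall>ys. list_all2 (\<in>) ys Vs \<longrightarrow> ys \<in> S"
      using K unfolding open_list_def by blast
    with S(1) show "\<exists>Vs. list_all2 (\<lambda>x V. open V \<and> x \<in> V) xs Vs \<and>
        (\<forall>ys. list_all2 (\<in>) ys Vs \<longrightarrow> ys \<in> \<Union>K)"
      by blast
  qed
qed

end

lemma open_Nil: "open {[] :: 'a::topological_space list}"
  unfolding open_list_def by auto

text \<open>Consing is a homeomorphism of \<open>'a \<times> 'a list\<close> onto the (clopen) set of nonempty lists.\<close>

lemma open_Cons_image:
  fixes U :: "('a::topological_space \<times> 'a list) set"
  shows "open ((\<lambda>(x, xs). x # xs) ` U) \<longleftrightarrow> open U"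
proof
  assume op: "open ((\<lambda>(x, xs). x # xs) ` U)"
  show "open U"
  proof (rule openI)
    fix p assume p: "p \<in> U"
    obtain x xs where px: "p = (x, xs)" by force
    with p have "x # xs \<in> (\<lambda>(x, xs). x # xs) ` U" by force
    with op obtain Ws where Ws: "list_all2 (\<lambda>x V. open V \<and> x \<in> V) (x # xs) Ws"
        "\<forall>ys. list_all2 (\<in>) ys Ws \<longrightarrow> ys \<in> (\<lambda>(x, xs). x # xs) ` U"
      unfolding open_list_def by blast
    obtain V Vs where V: "Ws = V # Vs" "open V" "x \<in> V"
        "list_all2 (\<lambda>x V. open V \<and> x \<in> V) xs Vs"
      using Ws(1) by (auto simp: list_all2_Cons1)
    have "open {ys. list_all2 (\<in>) ys Vs}"
      unfolding open_list_def
    proof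
      fix ys assume "ys \<in> {ys. list_all2 (\<in>) ys Vs}"
      then show "\<exists>Us. list_all2 (\<lambda>x V. open V \<and> x \<in> V) ys Us \<and>
          (\<forall>zs. list_all2 (\<in>) zs Us \<longrightarrow> zs \<in> {ys. list_all2 (\<in>) ys Vs})"
        using V(4) by (intro exI[of _ Vs]) (auto simp: list_all2_conv_all_nth)
    qed
    then have "open (V \<times> {ys. list_all2 (\<in>) ys Vs})" using V(2) by (rule open_Times[rotated])
    moreover have "p \<in> V \<times> {ys. list_all2 (\<in>) ys Vs}"
      using V px by (auto simp: list_all2_conv_all_nth)
    moreover have "V \<times> {ys. list_all2 (\<in>) ys Vs} \<subseteq> U"
    proof
      fix q assume "q \<in> V \<times> {ys. list_all2 (\<in>) ys Vs}"
      then obtain y ys where "q = (y, ys)" "list_all2 (\<in>) (y # ys) Ws" using V(1) by auto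
      with Ws(2) show "q \<in> U" by force
    qed
    ultimately show "\<exists>T. open T \<and> p \<in> T \<and> T \<subseteq> U" by blast
  qed
next
  assume op: "open U"
  show "open ((\<lambda>(x, xs). x # xs) ` U)"
    unfolding open_list_def
  proof
    fix l assume "l \<in> (\<lambda>(x, xs). x # xs) ` U"
    then obtain x xs where l: "l = x # xs" "(x, xs) \<in> U" by auto
    from open_prod_elim[OF op l(2)] obtain A B
      where AB: "open A" "open B" "(x, xs) \<in> A \<times> B" "A \<times> B \<subseteq> U" by blast
    then obtain Vs where "list_all2 (\<lambda>x V. open V \<and> x \<in> V) xs Vs"
        "\<forall>ys. list_all2 (\<in>) ys Vs \<longrightarrow> ys \<in> B"
      unfolding open_list_def by blast
    with AB l show "\<exists>Vs. list_all2 (\<lambda>x V. open V \<and> x \<in> V) l Vs \<and>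
        (\<forall>ys. list_all2 (\<in>) ys Vs \<longrightarrow> ys \<in> (\<lambda>(x, xs). x # xs) ` U)"
      by (intro exI[of _ "A # Vs"]) (force simp: list_all2_Cons2)
  qed
qed

instance prod :: (discrete_topology, discrete_topology) discrete_topology
proof
  fix A :: "('a \<times> 'b) set"
  have "A = (\<Union>p\<in>A. {fst p} \<times> {snd p})" by auto
  also have "open \<dots>" by (intro open_UN ballI open_Times open_discrete)
  finally show "open A" .
qed


section \<open>Problems and reducibility\<close>

text \<open>A problem maps an input to its set of admissible outputs; its domain consists of the inputs
  with at least one admissible output.\<close>

type_synonym ('a, 'b) problem = "'a \<Rightarrow> 'b set"

definition problem_dom :: "('a, 'b) problem \<Rightarrow> 'a set" where
  "problem_dom P = {w. P w \<noteq> {}}"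

definition choice_functions :: "('a, 'b) problem \<Rightarrow> ('a \<rightharpoonup> 'b) set" where
  "choice_functions P = {f. dom f = problem_dom P \<and> (\<forall>w\<in>dom f. the (f w) \<in> P w)}"

definition continuous_partial :: "('a::topological_space \<rightharpoonup> 'b::topological_space) \<Rightarrow> bool" where
  "continuous_partial f \<longleftrightarrow> continuous_on (dom f) (\<lambda>x. the (f x))"

text \<open>The composite partial function \<open>w \<mapsto> F (w, g (G w))\<close> is compared with the choice functions of
  \<open>P\<close> after restriction to the domain of \<open>P\<close>, on which it therefore has to be defined.\<close>

definition reducible ::
  "('a::topological_space, 'b::topological_space) problem \<Rightarrow>
   ('c::topological_space, 'd::topological_space) problem \<Rightarrow> bool"  (infix "\<le>\<^sub>2" 50) where
  "P \<le>\<^sub>2 Q \<longleftrightarrow>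
    (\<exists>(F :: 'a \<times> 'd \<rightharpoonup> 'b) (G :: 'a \<rightharpoonup> 'c). continuous_partial F \<and> continuous_partial G \<and>
      (\<forall>g\<in>choice_functions Q.
        (\<lambda>w. Option.bind (G w) (\<lambda>v. Option.bind (g v) (\<lambda>y. F (w, y)))) |` problem_dom P
          \<in> choice_functions P))"

definition problem_prod ::
  "('a, 'b) problem \<Rightarrow> ('c, 'd) problem \<Rightarrow> ('a \<times> 'c, 'b \<times> 'd) problem" where
  "problem_prod P Q = (\<lambda>(x, u). P x \<times> Q u)"

text \<open>The iterated pairs \<open>(x\<^sub>1, (x\<^sub>2, \<dots>))\<close> are written as lists, so that the powers of a problem
  share one type. The power with exponent \<open>0\<close> is the problem with a single input and a single
  output; thus the power with exponent \<open>1\<close> is the problem itself on one-element lists.\<close>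

fun problem_power :: "('a, 'b) problem \<Rightarrow> nat \<Rightarrow> ('a list, 'b list) problem" where
  "problem_power P 0 xs = (if xs = [] then {[]} else {})"
| "problem_power P (Suc z) [] = {}"
| "problem_power P (Suc z) (x # us) =
     (\<lambda>(y, v). y # v) ` problem_prod P (problem_power P z) (x, us)"

definition problem_Sup ::
  "'i::{countable, discrete_topology} set \<Rightarrow> ('i \<Rightarrow> ('a, 'b) problem) \<Rightarrow> ('i \<times> 'a, 'b) problem"
where
  "problem_Sup I P = (\<lambda>(i, w). if i \<in> I then P i w else {})"


section \<open>Representation of the reals\<close>

text \<open>\<open>total_recursive k f\<close>: the restriction of \<open>f\<close> to lists of length \<open>k\<close> is a total recursive
  function of \<open>k\<close> arguments (\<open>mu\<close> is minimisation of regular functions).\<close>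

inductive total_recursive :: "nat \<Rightarrow> (nat list \<Rightarrow> nat) \<Rightarrow> bool" where
  zero: "total_recursive k (\<lambda>_. 0)"
| succ: "total_recursive 1 (\<lambda>xs. Suc (xs ! 0))"
| proj: "i < k \<Longrightarrow> total_recursive k (\<lambda>xs. xs ! i)"
| comp: "total_recursive (length gs) f \<Longrightarrow> \<forall>g\<in>set gs. total_recursive k g \<Longrightarrow>
    total_recursive k (\<lambda>xs. f (map (\<lambda>g. g xs) gs))"
| prim_rec: "total_recursive k f \<Longrightarrow> total_recursive (Suc (Suc k)) g \<Longrightarrow>
    total_recursive (Suc k) (\<lambda>xs. rec_nat (f (tl xs)) (\<lambda>n r. g (n # r # tl xs)) (hd xs))"
| mu: "total_recursive (Suc k) f \<Longrightarrow> \<forall>xs. length xs = k \<longrightarrow> (\<exists>n. f (n # xs) = 0) \<Longrightarrow>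
    total_recursive k (\<lambda>xs. LEAST n. f (n # xs) = 0)"
| cong: "total_recursive k f \<Longrightarrow> \<forall>xs. length xs = k \<longrightarrow> f xs = g xs \<Longrightarrow> total_recursive k g"

text \<open>Division is made total by \<open>x / 0 = 0\<close>; this does not affect its computability.\<close>

definition computable_numbering :: "(nat \<Rightarrow> rat) \<Rightarrow> bool" where
  "computable_numbering \<nu> \<longleftrightarrow> bij \<nu> \<and> \<nu> 0 = 0 \<and>
     (\<forall>op\<in>{(+), (-), (*), (/)}.
        total_recursive 2 (\<lambda>xs. inv_into UNIV \<nu> (op (\<nu> (xs ! 0)) (\<nu> (xs ! 1)))))"

type_synonym name = "nat \<Rightarrow> nat"

definition real_name :: "(nat \<Rightarrow> rat) \<Rightarrow> name \<Rightarrow> real \<Rightarrow> bool" where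
  "real_name \<nu> w x \<longleftrightarrow> (\<forall>i. \<bar>of_rat (\<nu> (w i)) - x\<bar> \<le> 1 / 2 ^ i)"

definition vec_name :: "(nat \<Rightarrow> rat) \<Rightarrow> nat \<Rightarrow> name list \<Rightarrow> real vec \<Rightarrow> bool" where
  "vec_name \<nu> k ws x \<longleftrightarrow> length ws = k \<and> x \<in> carrier_vec k \<and> (\<forall>i<k. real_name \<nu> (ws ! i) (x $ i))"

text \<open>The entries of a matrix are listed row by row.\<close>

definition mat_name :: "(nat \<Rightarrow> rat) \<Rightarrow> nat \<Rightarrow> nat \<Rightarrow> name list \<Rightarrow> real mat \<Rightarrow> bool" where
  "mat_name \<nu> n m ws A \<longleftrightarrow> length ws = n * m \<and> A \<in> carrier_mat n m \<and>
     (\<forall>i<n. \<forall>j<m. real_name \<nu> (ws ! (i * m + j)) (A $$ (i, j)))"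

lemma real_name_unique:
  assumes "real_name \<nu> w x" "real_name \<nu> w y"
  shows "x = y"
proof (rule ccontr)
  assume "x \<noteq> y"
  then have "\<bar>x - y\<bar> / 2 > 0" by simp
  then obtain i where i: "(1 / 2 :: real) ^ i < \<bar>x - y\<bar> / 2"
    using real_arch_pow_inv[of "\<bar>x - y\<bar> / 2" "1 / 2"] by auto
  have "\<bar>of_rat (\<nu> (w i)) - x\<bar> \<le> 1 / 2 ^ i" "\<bar>of_rat (\<nu> (w i)) - y\<bar> \<le> 1 / 2 ^ i"
    using assms unfolding real_name_def by auto
  with i show False by (simp add: power_one_over)
qed

lemma real_name_exists:
  assumes "bij \<nu>"
  shows "\<exists>w. real_name \<nu> w x"
proof -
  have "\<exists>n. \<bar>of_rat (\<nu> n) - x\<bar> \<le> 1 / 2 ^ i" for i :: nat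
  proof -
    obtain q where q: "x < of_rat q" "of_rat q < x + 1 / 2 ^ i"
      using of_rat_dense[of x "x + 1 / 2 ^ i"] by auto
    obtain n where "\<nu> n = q" using assms by (metis bij_pointE)
    with q show ?thesis by (intro exI[of _ n]) auto
  qed
  then show ?thesis unfolding real_name_def by metis
qed


section \<open>Robust division and bounded linear inequalities\<close>

definition rDiv :: "(nat \<Rightarrow> rat) \<Rightarrow> (name \<times> name, name) problem" where
  "rDiv \<nu> = (\<lambda>(u, v). {d. \<exists>x y r. real_name \<nu> u x \<and> real_name \<nu> v y \<and> 0 \<le> x \<and> x \<le> y \<and>
     real_name \<nu> d r \<and> (y > 0 \<longrightarrow> r = x / y)})"

lemma problem_dom_rDiv:
  assumes "bij \<nu>"
  shows "problem_dom (rDiv \<nu>) =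
    {(u, v). \<exists>x y. real_name \<nu> u x \<and> real_name \<nu> v y \<and> 0 \<le> x \<and> x \<le> y}"
  using real_name_exists[OF assms] unfolding problem_dom_def rDiv_def by auto blast

text \<open>The inequalities \<open>0 \<le> v\<close> and \<open>v \<le> 1\<close> occur among the rows of \<open>A v \<le> b\<close>.\<close>

definition contains_box :: "nat \<Rightarrow> nat \<Rightarrow> real mat \<Rightarrow> real vec \<Rightarrow> bool" where
  "contains_box n m A b \<longleftrightarrow> (\<forall>j<m.
     (\<exists>i<n. row A i = - unit_vec m j \<and> b $ i = 0) \<and>
     (\<exists>i<n. row A i = unit_vec m j \<and> b $ i = 1))"

definition BLinIneq_dim ::
  "(nat \<Rightarrow> rat) \<Rightarrow> nat \<Rightarrow> nat \<Rightarrow> (name list \<times> name list, name list) problem" where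
  "BLinIneq_dim \<nu> n m = (\<lambda>(as, bs). {vs. \<exists>A b v. mat_name \<nu> n m as A \<and> vec_name \<nu> n bs b \<and>
     contains_box n m A b \<and> vec_name \<nu> m vs v \<and>
     A *\<^sub>v v \<le> b \<and> 0\<^sub>v m \<le> v \<and> v \<le> vec m (\<lambda>_. 1)})"

lemma problem_dom_BLinIneq_dim:
  assumes "bij \<nu>"
  shows "problem_dom (BLinIneq_dim \<nu> n m) =
    {(as, bs). \<exists>A b. mat_name \<nu> n m as A \<and> vec_name \<nu> n bs b \<and> contains_box n m A b \<and>
      (\<exists>v\<in>carrier_vec m. A *\<^sub>v v \<le> b \<and> 0\<^sub>v m \<le> v \<and> v \<le> vec m (\<lambda>_. 1))}"
proof -
  obtain N where "\<And>x. real_name \<nu> (N x) x" using real_name_exists[OF assms] by metis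
  then have "vec_name \<nu> m (map (\<lambda>i. N (v $ i)) [0..<m]) v" if "v \<in> carrier_vec m" for v
    using that unfolding vec_name_def by auto
  moreover have "v \<in> carrier_vec m" if "vec_name \<nu> m vs v" for vs v
    using that unfolding vec_name_def by auto
  ultimately show ?thesis
    unfolding problem_dom_def BLinIneq_dim_def by auto blast+
qed

definition BLinIneq ::
  "(nat \<Rightarrow> rat) \<Rightarrow> ((nat \<times> nat) \<times> (name list \<times> name list), name list) problem" where
  "BLinIneq \<nu> = problem_Sup {(n, m). 1 \<le> n \<and> 1 \<le> m} (\<lambda>(n, m). BLinIneq_dim \<nu> n m)"

end

theory Submission
  imports Defs
begin

text \<open>The quotient \<open>d = x / y\<close> is the solution of the two inequalities \<open>y d \<le> x\<close> and \<open>- y d \<le> - x\<close>,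
  which hold for every \<open>d\<close> if \<open>y = 0\<close>, since then \<open>x = 0\<close>. As \<open>0 \<le> x \<le> y\<close>, the bounds
  \<open>0 \<le> d \<le> 1\<close> may be added without losing solvability. So \<open>z\<close> divisions amount to a solvable system
  of \<open>4 z\<close> inequalities in \<open>z\<close> unknowns, whose entries depend continuously on the input.\<close>

text \<open>A choice function \<open>g\<close> enters the composite only through its value at
  \<open>G w\<close>, so it suffices to treat every admissible \<open>y\<close> at each
  \<open>w\<close>. The partial maps demanded by \<open>\<le>\<^sub>2\<close> are the restrictions
  of the total \<open>F\<close> and \<open>G\<close> to the sets on which continuity is
  assumed.\<close>

lemma reducibleI:
  fixes P :: "('a::topological_space, 'b::topological_space) problem"
    and Q :: "('c::topological_space, 'd::topological_space) problem"
  assumes F: "continuous_on (problem_dom P \<times> UNIV) F"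
    and G: "continuous_on (problem_dom P) G"
    and dom: "\<And>w. w \<in> problem_dom P \<Longrightarrow> G w \<in> problem_dom Q"
    and sol: "\<And>w y. w \<in> problem_dom P \<Longrightarrow> y \<in> Q (G w) \<Longrightarrow> F (w, y) \<in> P w"
  shows "P \<le>\<^sub>2 Q"
  unfolding reducible_def
proof (intro exI conjI ballI)
  let ?F = "(\<lambda>p. Some (F p)) |` (problem_dom P \<times> UNIV)"
  let ?G = "(\<lambda>w. Some (G w)) |` problem_dom P"
  show "continuous_partial ?F"
    unfolding continuous_partial_def using F by (simp add: dom_def restrict_map_def cong: continuous_on_cong)
  show "continuous_partial ?G"
    unfolding continuous_partial_def using G by (simp add: dom_def restrict_map_def cong: continuous_on_cong)
  fix g assume g: "g \<in> choice_functions Q"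
  have "\<exists>y. g (G w) = Some y \<and> y \<in> Q (G w)" if "w \<in> problem_dom P" for w
  proof -
    have "G w \<in> dom g" "the (g (G w)) \<in> Q (G w)"
      using dom[OF that] g unfolding choice_functions_def by auto
    then show ?thesis by auto
  qed
  then show "(\<lambda>w. Option.bind (?G w) (\<lambda>v. Option.bind (g v) (\<lambda>y. ?F (w, y)))) |` problem_dom P
      \<in> choice_functions P"
    using sol unfolding choice_functions_def
    by (fastforce simp: restrict_map_def dom_def split: if_splits)
qed

text \<open>The recursion unfolds coordinate by coordinate; an input of the wrong length ends in a
  clause with no outputs.\<close>

lemma in_problem_power_iff:
  "ys \<in> problem_power P z xs \<longleftrightarrow> length xs = z \<and> list_all2 (\<lambda>x y. y \<in> P x) xs ys"
  by (induction P z xs arbitrary: ys rule: problem_power.induct)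
    (auto simp: problem_prod_def list_all2_Cons1 image_iff)


section \<open>Continuity\<close>

lemma open_list_all2_mem:
  assumes "\<And>V. V \<in> set Vs \<Longrightarrow> open V"
  shows "open {xs. list_all2 (\<in>) xs Vs}"
  unfolding open_list_def using assms by (auto simp: list_all2_conv_all_nth intro!: exI[of _ Vs])

lemma continuous_on_nth:
  assumes "\<And>xs. xs \<in> A \<Longrightarrow> i < length xs"
  shows "continuous_on A (\<lambda>xs. xs ! i)"
  unfolding continuous_on_topological
proof (intro ballI allI impI)
  fix xs :: "'a list" and B :: "'a set"
  assume xs: "xs \<in> A" and B: "open B" "xs ! i \<in> B"
  \<comment> \<open>This box constrains coordinate \<open>i\<close> only, and its length admits only
    lists as long as \<open>xs\<close>.\<close>
  let ?Vs = "(map (\<lambda>_. UNIV) xs)[i := B]"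
  have "open {ys. list_all2 (\<in>) ys ?Vs}"
    using B(1) by (intro open_list_all2_mem) (auto dest!: set_update_subset_insert[THEN subsetD])
  moreover have "xs \<in> {ys. list_all2 (\<in>) ys ?Vs}"
    using B(2) assms[OF xs] by (auto simp: list_all2_conv_all_nth nth_list_update)
  moreover have "ys ! i \<in> B" if "list_all2 (\<in>) ys ?Vs" for ys
    using that assms[OF xs] by (auto simp: list_all2_conv_all_nth nth_list_update)
  ultimately show "\<exists>U. open U \<and> xs \<in> U \<and> (\<forall>ys\<in>A. ys \<in> U \<longrightarrow> ys ! i \<in> B)"
    by blast
qed

text \<open>A basic neighbourhood of the value is a box with one factor for each entry of
  \<open>is\<close>, so finitely many preimage neighbourhoods have to be intersected.\<close>

lemma continuous_on_map_fixed_list: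
  assumes "\<And>i. i \<in> set is \<Longrightarrow> continuous_on A (f i)"
  shows "continuous_on A (\<lambda>x. map (\<lambda>i. f i x) is)"
  unfolding continuous_on_topological
proof (intro ballI allI impI)
  fix x B assume x: "x \<in> A" and B: "open B" "map (\<lambda>i. f i x) is \<in> B"
  obtain Vs where Vs: "list_all2 (\<lambda>x V. open V \<and> x \<in> V) (map (\<lambda>i. f i x) is) Vs"
      "\<And>ys. list_all2 (\<in>) ys Vs \<Longrightarrow> ys \<in> B"
    using B unfolding open_list_def by blast
  have "\<exists>U. open U \<and> x \<in> U \<and> (\<forall>y\<in>A. y \<in> U \<longrightarrow> f (is ! k) y \<in> Vs ! k)" if "k < length is" for k
    using assms[OF nth_mem[OF that]] x Vs(1) that
    unfolding continuous_on_topological by (auto simp: list_all2_conv_all_nth)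
  then obtain U where U: "\<And>k. k < length is \<Longrightarrow>
      open (U k) \<and> x \<in> U k \<and> (\<forall>y\<in>A. y \<in> U k \<longrightarrow> f (is ! k) y \<in> Vs ! k)"
    by metis
  show "\<exists>U. open U \<and> x \<in> U \<and> (\<forall>y\<in>A. y \<in> U \<longrightarrow> map (\<lambda>i. f i y) is \<in> B)"
  proof (intro exI conjI ballI impI)
    show "open (\<Inter>k<length is. U k)" "x \<in> (\<Inter>k<length is. U k)" using U by auto
    fix y assume "y \<in> A" "y \<in> (\<Inter>k<length is. U k)"
    then show "map (\<lambda>i. f i y) is \<in> B"
      using U Vs by (auto simp: list_all2_conv_all_nth)
  qed
qed

text \<open>Each slice over a discrete index is relatively open. This lets the reduction depend on
  the number of divisions in an arbitrary way.\<close>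

lemma continuous_on_discrete_fst:
  fixes f :: "'i::discrete_topology \<times> 'a::topological_space \<Rightarrow> 'b::topological_space"
  assumes "\<And>i. continuous_on {x. (i, x) \<in> A} (\<lambda>x. f (i, x))"
  shows "continuous_on A f"
  unfolding continuous_on_topological
proof (intro ballI allI impI)
  fix p B assume p: "p \<in> A" and B: "open B" "f p \<in> B"
  obtain i x where [simp]: "p = (i, x)" by force
  have "x \<in> {x. (i, x) \<in> A}" "f (i, x) \<in> B" using p B by auto
  then obtain U where U: "open U" "x \<in> U" "\<forall>y\<in>{x. (i, x) \<in> A}. y \<in> U \<longrightarrow> f (i, y) \<in> B"
    using assms[of i] B(1) unfolding continuous_on_topological by blast
  have "open ({i} \<times> U)" using U(1) by (intro open_Times open_discrete)
  then show "\<exists>U. open U \<and> p \<in> U \<and> (\<forall>y\<in>A. y \<in> U \<longrightarrow> f y \<in> B)"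
    using U by (intro exI[of _ "{i} \<times> U"]) auto
qed


section \<open>Names\<close>

definition const_name :: "(nat \<Rightarrow> rat) \<Rightarrow> rat \<Rightarrow> name" where
  "const_name \<nu> q = (\<lambda>_. inv_into UNIV \<nu> q)"

definition uminus_name :: "(nat \<Rightarrow> rat) \<Rightarrow> name \<Rightarrow> name" where
  "uminus_name \<nu> w = (\<lambda>i. inv_into UNIV \<nu> (- \<nu> (w i)))"

lemma real_name_const_name: "bij \<nu> \<Longrightarrow> real_name \<nu> (const_name \<nu> q) (of_rat q)"
  by (simp add: real_name_def const_name_def bij_is_surj surj_f_inv_f)

text \<open>Negation preserves distances, so the error bounds survive without a shift of the
  index.\<close>

lemma real_name_uminus_name: "bij \<nu> \<Longrightarrow> real_name \<nu> w x \<Longrightarrow> real_name \<nu> (uminus_name \<nu> w) (- x)"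
  by (simp add: real_name_def uminus_name_def bij_is_surj surj_f_inv_f of_rat_minus abs_minus_commute)

text \<open>Negation acts entry by entry, and every map between discrete spaces is
  continuous.\<close>

lemma continuous_on_uminus_name [continuous_intros]:
  assumes "continuous_on A f"
  shows "continuous_on A (\<lambda>x. uminus_name \<nu> (f x))"
proof -
  have "continuous_on A (\<lambda>x. inv_into UNIV \<nu> (- \<nu> (f x i)))" for i
    by (rule continuous_on_compose2[OF continuous_on_discrete[of UNIV "\<lambda>n. inv_into UNIV \<nu> (- \<nu> n)"]])
      (use assms continuous_on_product_then_coordinatewise in auto)
  then show ?thesis unfolding uminus_name_def by (rule continuous_on_coordinatewise_then_product)
qed

text \<open>\<open>BLinIneq_dim\<close> only says that some matrix is named by the input; uniqueness
  identifies it with the constructed one.\<close>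

lemma mat_name_unique:
  assumes "mat_name \<nu> n m ws A" "mat_name \<nu> n m ws B"
  shows "A = B"
  using assms unfolding mat_name_def by (intro eq_matI) (auto, metis real_name_unique)

lemma vec_name_unique:
  assumes "vec_name \<nu> n ws x" "vec_name \<nu> n ws y"
  shows "x = y"
  using assms unfolding vec_name_def by (intro eq_vecI) (auto, metis real_name_unique)


section \<open>The linear system of a list of divisions\<close>

text \<open>The rows \<open>4 k, \<dots>, 4 k + 3\<close> are \<open>y\<^sub>k v\<^sub>k \<le> x\<^sub>k\<close>, \<open>- y\<^sub>k v\<^sub>k \<le> - x\<^sub>k\<close>, \<open>- v\<^sub>k \<le> 0\<close>, \<open>v\<^sub>k \<le> 1\<close>.\<close>

definition div_mat :: "nat \<Rightarrow> (nat \<Rightarrow> real) \<Rightarrow> real mat" where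
  "div_mat z y = mat (4 * z) z (\<lambda>(i, j).
     if j = i div 4 then [y j, - y j, - 1, 1] ! (i mod 4) else 0)"

definition div_vec :: "nat \<Rightarrow> (nat \<Rightarrow> real) \<Rightarrow> real vec" where
  "div_vec z x = vec (4 * z) (\<lambda>i. [x (i div 4), - x (i div 4), 0, 1] ! (i mod 4))"

text \<open>Flattened row by row: position \<open>l\<close> holds row \<open>l div z\<close> and
  column \<open>l mod z\<close> of \<open>div_mat\<close>.\<close>

definition div_mat_name :: "(nat \<Rightarrow> rat) \<Rightarrow> nat \<Rightarrow> (name \<times> name) list \<Rightarrow> name list" where
  "div_mat_name \<nu> z ps = map (\<lambda>l.
     if l mod z = l div z div 4
     then [snd (ps ! (l mod z)), uminus_name \<nu> (snd (ps ! (l mod z))),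
           const_name \<nu> (- 1), const_name \<nu> 1] ! (l div z mod 4)
     else const_name \<nu> 0) [0..<4 * z * z]"

definition div_vec_name :: "(nat \<Rightarrow> rat) \<Rightarrow> nat \<Rightarrow> (name \<times> name) list \<Rightarrow> name list" where
  "div_vec_name \<nu> z ps = map (\<lambda>i.
     [fst (ps ! (i div 4)), uminus_name \<nu> (fst (ps ! (i div 4))),
      const_name \<nu> 0, const_name \<nu> 1] ! (i mod 4)) [0..<4 * z]"

lemma less_4_cases: "(n::nat) mod 4 = 0 \<or> n mod 4 = 1 \<or> n mod 4 = 2 \<or> n mod 4 = 3"
  by linarith

text \<open>All case distinctions depend on the position \<open>l\<close>, never on
  \<open>ps\<close>. Each entry is thus a constant name, a component of some \<open>ps ! k\<close>,
  or the negation of one.\<close>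

lemma continuous_on_div_mat_name:
  assumes "\<And>ps. ps \<in> A \<Longrightarrow> length ps = z"
  shows "continuous_on A (div_mat_name \<nu> z)"
  unfolding div_mat_name_def
proof (rule continuous_on_map_fixed_list)
  fix l assume "l \<in> set [0..<4 * z * z]"
  then have "l mod z < z" by (cases "z = 0") auto
  then have "continuous_on A (\<lambda>ps. ps ! (l mod z))"
    by (intro continuous_on_nth) (auto dest: assms)
  then show "continuous_on A (\<lambda>ps. if l mod z = l div z div 4
     then [snd (ps ! (l mod z)), uminus_name \<nu> (snd (ps ! (l mod z))),
           const_name \<nu> (- 1), const_name \<nu> 1] ! (l div z mod 4)
     else const_name \<nu> 0)"
    using less_4_cases[of "l div z"]
    by (cases "l mod z = l div z div 4")
      (auto simp del: mod_less simp: numeral_2_eq_2 numeral_3_eq_3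
        intro!: continuous_on_uminus_name continuous_on_fst continuous_on_snd)
qed

lemma continuous_on_div_vec_name:
  assumes "\<And>ps. ps \<in> A \<Longrightarrow> length ps = z"
  shows "continuous_on A (div_vec_name \<nu> z)"
  unfolding div_vec_name_def
proof (rule continuous_on_map_fixed_list)
  fix i assume "i \<in> set [0..<4 * z]"
  then have "continuous_on A (\<lambda>ps. ps ! (i div 4))"
    by (intro continuous_on_nth) (auto dest!: assms)
  then show "continuous_on A (\<lambda>ps. [fst (ps ! (i div 4)), uminus_name \<nu> (fst (ps ! (i div 4))),
      const_name \<nu> 0, const_name \<nu> 1] ! (i mod 4))"
    using less_4_cases[of i]
    by (auto simp: numeral_2_eq_2 numeral_3_eq_3
        intro!: continuous_on_uminus_name continuous_on_fst continuous_on_snd)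
qed

lemma mat_name_div_mat_name:
  assumes "bij \<nu>" and "\<And>k. k < z \<Longrightarrow> real_name \<nu> (snd (ps ! k)) (y k)"
  shows "mat_name \<nu> (4 * z) z (div_mat_name \<nu> z ps) (div_mat z y)"
  unfolding mat_name_def
proof (intro conjI allI impI)
  fix i j assume ij: "i < 4 * z" "j < z"
  have "i * z + j < 4 * z * z"
  proof -
    have "i * z + j < Suc i * z" using ij by simp
    also have "\<dots> \<le> 4 * z * z" using ij by (intro mult_right_mono) auto
    finally show ?thesis .
  qed
  then show "real_name \<nu> (div_mat_name \<nu> z ps ! (i * z + j)) (div_mat z y $$ (i, j))"
    using ij less_4_cases[of i] assms(2)[of j] real_name_const_name[OF assms(1), of 0]
      real_name_const_name[OF assms(1), of 1] real_name_const_name[OF assms(1), of "- 1"]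
    by (auto simp: div_mat_name_def div_mat_def numeral_2_eq_2 numeral_3_eq_3 of_rat_minus
        intro: real_name_uminus_name[OF assms(1)])
qed (auto simp: div_mat_name_def div_mat_def)

lemma vec_name_div_vec_name:
  assumes "bij \<nu>" and "\<And>k. k < z \<Longrightarrow> real_name \<nu> (fst (ps ! k)) (x k)"
  shows "vec_name \<nu> (4 * z) (div_vec_name \<nu> z ps) (div_vec z x)"
  unfolding vec_name_def
proof (intro conjI allI impI)
  fix i assume "i < 4 * z"
  then show "real_name \<nu> (div_vec_name \<nu> z ps ! i) (div_vec z x $ i)"
    using less_4_cases[of i] assms(2)[OF less_mult_imp_div_less[of i z 4]] real_name_const_name[OF assms(1), of 0]
      real_name_const_name[OF assms(1), of 1]
    by (auto simp: div_vec_name_def div_vec_def numeral_2_eq_2 numeral_3_eq_3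
        intro: real_name_uminus_name[OF assms(1)])
qed (auto simp: div_vec_name_def div_vec_def)

lemma contains_box_div_mat: "contains_box (4 * z) z (div_mat z y) (div_vec z x)"
  unfolding contains_box_def
proof (intro allI impI conjI)
  fix j assume j: "j < z"
  \<comment> \<open>Rows \<open>4 * j + 2\<close> and \<open>4 * j + 3\<close> carry the bounds on
    unknown \<open>j\<close>.\<close>
  have *: "(4 * j + 2) div 4 = j" "(4 * j + 3) div 4 = j"
    "(4 * j + 2) mod 4 = 2" "(4 * j + 3) mod 4 = 3" by presburger+
  show "\<exists>i<4 * z. row (div_mat z y) i = - unit_vec z j \<and> div_vec z x $ i = 0"
    using j * by (intro exI[of _ "4 * j + 2"])
      (auto intro!: eq_vecI simp: div_mat_def div_vec_def unit_vec_def)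
  show "\<exists>i<4 * z. row (div_mat z y) i = unit_vec z j \<and> div_vec z x $ i = 1"
    using j * by (intro exI[of _ "4 * j + 3"])
      (auto intro!: eq_vecI simp: div_mat_def div_vec_def unit_vec_def)
qed

lemma dim_row_div_mat: "dim_row (div_mat z y) = 4 * z"
  by (simp add: div_mat_def)

lemma div_mat_mult_vec_nth:
  assumes "v \<in> carrier_vec z" "i < 4 * z"
  shows "(div_mat z y *\<^sub>v v) $ i
    = [y (i div 4), - y (i div 4), - 1, 1] ! (i mod 4) * v $ (i div 4)"
proof -
  have "(div_mat z y *\<^sub>v v) $ i = (\<Sum>j<z. div_mat z y $$ (i, j) * v $ j)"
    using assms by (simp add: div_mat_def scalar_prod_def atLeast0LessThan)
  \<comment> \<open>Row \<open>i\<close> vanishes outside column \<open>i div 4\<close>, so the sum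
    collapses to one term.\<close>
  also have "\<dots> = (\<Sum>j<z. if j = i div 4
      then [y (i div 4), - y (i div 4), - 1, 1] ! (i mod 4) * v $ (i div 4) else 0)"
    using assms(2) by (intro sum.cong) (auto simp: div_mat_def)
  also have "\<dots> = [y (i div 4), - y (i div 4), - 1, 1] ! (i mod 4) * v $ (i div 4)"
    using assms(2) by simp
  finally show ?thesis .
qed

lemma div_mat_mult_vec_le_iff:
  assumes v: "v \<in> carrier_vec z"
  shows "div_mat z y *\<^sub>v v \<le> div_vec z x
    \<longleftrightarrow> (\<forall>k<z. y k * v $ k = x k \<and> 0 \<le> v $ k \<and> v $ k \<le> 1)"
proof -
  let ?le = "\<lambda>k r. [y k, - y k, - 1, 1] ! r * v $ k \<le> [x k, - x k, 0, 1] ! r"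
  have "div_mat z y *\<^sub>v v \<le> div_vec z x \<longleftrightarrow> (\<forall>i<4 * z. ?le (i div 4) (i mod 4))"
    using v by (auto simp: less_eq_vec_def div_mat_mult_vec_nth div_vec_def dim_row_div_mat
        simp del: index_mult_mat_vec)
  \<comment> \<open>Each row index below \<open>4 * z\<close> is \<open>4 * k + r\<close> with
    \<open>k < z\<close> and \<open>r < 4\<close>.\<close>
  also have "\<dots> \<longleftrightarrow> (\<forall>k<z. \<forall>r<4. ?le k r)"
  proof (intro iffI allI impI)
    fix k r :: nat
    assume "\<forall>i<4 * z. ?le (i div 4) (i mod 4)" "k < z" "r < 4"
    moreover have "4 * k + r < 4 * z" using calculation by linarith
    ultimately have "?le ((4 * k + r) div 4) ((4 * k + r) mod 4)" by blast
    with \<open>r < 4\<close> show "?le k r" by simp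
  next
    fix i assume "\<forall>k<z. \<forall>r<4. ?le k r" "i < 4 * z"
    then show "?le (i div 4) (i mod 4)" by simp
  qed
  \<comment> \<open>The opposite inequalities for \<open>r = 0\<close> and \<open>r = 1\<close>
    merge into an equation; \<open>r = 2\<close> and \<open>r = 3\<close> give the bounds.\<close>
  also have "\<dots> \<longleftrightarrow> (\<forall>k<z. y k * v $ k = x k \<and> 0 \<le> v $ k \<and> v $ k \<le> 1)"
    by (auto simp: numeral_eq_Suc All_less_Suc)
  finally show ?thesis .
qed

section \<open>Inputs of the powers of division, and the reduction\<close>

lemma problem_dom_power_rDiv:
  assumes "bij \<nu>" "ps \<in> problem_dom (problem_power (rDiv \<nu>) z)"
  obtains x y where "length ps = z"
    and "\<And>k. k < z \<Longrightarrow> real_name \<nu> (fst (ps ! k)) (x k)"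
    and "\<And>k. k < z \<Longrightarrow> real_name \<nu> (snd (ps ! k)) (y k)"
    and "\<And>k. k < z \<Longrightarrow> 0 \<le> x k \<and> x k \<le> y k"
proof -
  obtain ds where len: "length ps = z" and ds: "list_all2 (\<lambda>p d. d \<in> rDiv \<nu> p) ps ds"
    using assms(2) unfolding problem_dom_def by (auto simp flip: ex_in_conv simp: in_problem_power_iff)
  \<comment> \<open>The guard \<open>k < z\<close> stands under the existentials, so that choice
    yields \<open>x\<close> and \<open>y\<close> as functions on all naturals.\<close>
  have "\<forall>k. \<exists>x y. k < z \<longrightarrow> real_name \<nu> (fst (ps ! k)) x \<and> real_name \<nu> (snd (ps ! k)) y
      \<and> 0 \<le> x \<and> x \<le> y"
    using ds len by (fastforce simp: list_all2_conv_all_nth rDiv_def split_beta)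
  then show ?thesis using len that by metis
qed

theorem theorem31:
  fixes \<nu> :: "nat \<Rightarrow> rat"
  assumes "computable_numbering \<nu>"
  shows "problem_Sup {z. 1 \<le> z} (\<lambda>z. problem_power (rDiv \<nu>) z) \<le>\<^sub>2 BLinIneq \<nu>"
proof (rule reducibleI)
  let ?P = "problem_Sup {z. 1 \<le> z} (\<lambda>z. problem_power (rDiv \<nu>) z)"
  let ?G = "\<lambda>(z, ps). ((4 * z, z), (div_mat_name \<nu> z ps, div_vec_name \<nu> z ps))"
  have bij: "bij \<nu>" using assms unfolding computable_numbering_def by blast
  have dom: "1 \<le> z \<and> ps \<in> problem_dom (problem_power (rDiv \<nu>) z)"
    if "(z, ps) \<in> problem_dom ?P" for z ps
    using that by (auto simp: problem_dom_def problem_Sup_def split: if_splits)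
  \<comment> \<open>The solution names are already the names of the quotients, so the outer map
    merely returns the answer.\<close>
  show "continuous_on (problem_dom ?P \<times> UNIV) snd" by (intro continuous_intros)
  show "continuous_on (problem_dom ?P) ?G"
  proof (rule continuous_on_discrete_fst)
    fix z
    have "length ps = z" if "ps \<in> {ps. (z, ps) \<in> problem_dom ?P}" for ps
      using that dom problem_dom_power_rDiv[OF bij] by blast
    then show "continuous_on {ps. (z, ps) \<in> problem_dom ?P} (\<lambda>ps. ?G (z, ps))"
      by (auto intro!: continuous_intros continuous_on_div_mat_name continuous_on_div_vec_name)
  qed
  fix w assume w: "w \<in> problem_dom ?P"
  obtain z ps where [simp]: "w = (z, ps)" by force
  obtain x y where len: "length ps = z"
    and x: "\<And>k. k < z \<Longrightarrow> real_name \<nu> (fst (ps ! k)) (x k)"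
    and y: "\<And>k. k < z \<Longrightarrow> real_name \<nu> (snd (ps ! k)) (y k)"
    and xy: "\<And>k. k < z \<Longrightarrow> 0 \<le> x k \<and> x k \<le> y k"
    using problem_dom_power_rDiv[OF bij] dom w by (metis \<open>w = (z, ps)\<close>)
  have z: "1 \<le> z" using dom w by simp
  note names = mat_name_div_mat_name[OF bij y] vec_name_div_vec_name[OF bij x]
  show "?G w \<in> problem_dom (BLinIneq \<nu>)"
  proof -
    \<comment> \<open>Where \<open>y k = 0\<close>, the convention \<open>x k / 0 = 0\<close> picks
      the value 0; this fits, since \<open>x k = 0\<close> as well.\<close>
    define v where "v = vec z (\<lambda>k. x k / y k)"
    have v: "v \<in> carrier_vec z" by (simp add: v_def)
    have "y k * v $ k = x k \<and> 0 \<le> v $ k \<and> v $ k \<le> 1" if "k < z" for k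
      using xy[OF that] that by (cases "y k = 0") (auto simp: v_def)
    then have "div_mat z y *\<^sub>v v \<le> div_vec z x" "0\<^sub>v z \<le> v" "v \<le> vec z (\<lambda>_. 1)"
      using v div_mat_mult_vec_le_iff[OF v, of y x] by (auto simp: less_eq_vec_def)
    with v names contains_box_div_mat
    have "(div_mat_name \<nu> z ps, div_vec_name \<nu> z ps) \<in> problem_dom (BLinIneq_dim \<nu> (4 * z) z)"
      unfolding problem_dom_BLinIneq_dim[OF bij] by blast
    then show ?thesis
      using z by (simp add: problem_dom_def BLinIneq_def problem_Sup_def)
  qed
  fix ds assume "ds \<in> BLinIneq \<nu> (?G w)"
  then obtain A b v where A: "mat_name \<nu> (4 * z) z (div_mat_name \<nu> z ps) A"
    and b: "vec_name \<nu> (4 * z) (div_vec_name \<nu> z ps) b"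
    and v: "vec_name \<nu> z ds v" and le: "A *\<^sub>v v \<le> b"
    using z by (auto simp: BLinIneq_def problem_Sup_def BLinIneq_dim_def)
  have Ab: "A = div_mat z y" "b = div_vec z x"
    using mat_name_unique[OF A names(1)] vec_name_unique[OF b names(2)] by auto
  have carr: "v \<in> carrier_vec z" using v unfolding vec_name_def by blast
  have "y k * v $ k = x k" if "k < z" for k
    using le that unfolding Ab div_mat_mult_vec_le_iff[OF carr] by blast
  \<comment> \<open>A coordinate with \<open>y k = 0\<close> may be any real, as \<open>rDiv\<close>
    allows.\<close>
  then have "y k > 0 \<longrightarrow> v $ k = x k / y k" if "k < z" for k
    using that by (simp add: eq_divide_eq mult.commute)
  moreover have "real_name \<nu> (ds ! k) (v $ k)" if "k < z" for k
    using v that by (simp add: vec_name_def)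
  ultimately have "ds ! k \<in> rDiv \<nu> (ps ! k)" if "k < z" for k
    using x y xy that unfolding rDiv_def split_beta by blast
  then show "snd (w, ds) \<in> ?P w"
    using z len v
    by (auto simp: problem_Sup_def in_problem_power_iff list_all2_conv_all_nth vec_name_def)
qed

end
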